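(* Let $n$ be the size of the weighted process tree $T$. To obtain a random execution (a uniformly random concurrent run) of $T$ with the random run generation algorithm described in the context, with the multiset implemented by a (balanced) partial sum tree, one needs $n$ random choices of integers, and the operations on the multiset are of order $\Theta(n\log n)$ in the worst case.
   Context: A process tree is a plane rooted tree $T$ whose nodes carry pairwise distinct names (actions); its size $|T|$ is its number of nodes; $T(v)$ is the subtree of all descendants of the node $v$ (including $v$). "Weighted" means that each node $v$ stores the integer $|T(v)|$. The concurrent runs of $T$ are the orderings of all the nodes of $T$ in which each node appears after its parent. Algorithm. Maintain a sequence $\sigma$, initially empty, and a multiset $M$ of nodes of $T$ with non-negative integer weights $M(\cdot)$, initially containing only the root with weight $|T|$. For $p=1,\dots,|T|$: sample an action $\alpha$ from $M$ with probability $M(\alpha)/|M|$, where $|M|=\sum_\beta M(\beta)$; append $\alpha$ to $\sigma$; set the weight of $\alpha$ in $M$ to $0$; for each child $\beta$ of $\alpha$ in $T$, set the weight of $\beta$ in $M$ to $|T(\beta)|$. Return $\sigma$. Partial sum tree. The multiset is stored as a balanced binary tree; each tree node stores one element $\alpha$ with its weight, together with the total weights of its left and right subtrees. Sampling draws one uniform random integer $\rho\in\{1,\dots,|M|\}$ and descends from the root: at a node with left total weight $\ell$ and element $\alpha$ of weight $k$, go left with $\rho$ if $\rho\le\ell$; return $\alpha$ if $\ell<\rho\le\ell+k$; otherwise go right with $\rho-(\ell+k)$. An update (changing a weight, inserting or removing an element) modifies the sums on the path from the affected node to the root. Each sampling or update thus costs time proportional to the depth visited, which is at most logarithmic in the number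 of stored elements. *)

theory Defs
  imports
    "HOL-Probability.Probability"
    "HOL-Library.Tree"
    "HOL-Library.Tree_Real"
    "HOL-Library.Landau_Symbols"
begin

section \<open>Weighted process trees and concurrent runs\<close>

datatype 'a process = Process (act: 'a) (weight: nat) (subs: "'a process list")

text \<open>
  A node is represented by the subtree rooted at it, so \<open>nodes T\<close> lists the
  subtrees \<open>T(v)\<close> of all nodes \<open>v\<close> and its length is the size of \<open>T\<close>.
\<close>

fun nodes :: "'a process \<Rightarrow> 'a process list" where
  "nodes (Process a w ts) = Process a w ts # concat (map nodes ts)"

definition actions :: "'a process \<Rightarrow> 'a list" where
  "actions T = map act (nodes T)"

definition weighted_process_trees :: "nat \<Rightarrow> 'a process set" where
  "weighted_process_trees n =
     {T. length (nodes T) = n \<and> distinct (actions T) \<and>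
         (\<forall>s \<in> set (nodes T). weight s = length (nodes s))}"

definition concurrent_runs :: "'a process \<Rightarrow> 'a list set" where
  "concurrent_runs T =
     {\<sigma>. distinct \<sigma> \<and> set \<sigma> = set (actions T) \<and>
         (\<forall>s \<in> set (nodes T). \<forall>c \<in> set (subs s). \<forall>i < length \<sigma>. \<forall>j < length \<sigma>.
            \<sigma> ! i = act s \<longrightarrow> \<sigma> ! j = act c \<longrightarrow> i < j)}"

definition children :: "'a process \<Rightarrow> 'a \<Rightarrow> 'a process list" where
  "children T a = subs (the (find (\<lambda>s. act s = a) (nodes T)))"


section \<open>Partial sum trees\<close>

text \<open>
  A node label \<open>(a, k, x, y)\<close> holds the element \<open>a\<close>, its weight \<open>k\<close>, and the stored
  total weights \<open>x\<close> and \<open>y\<close> of the left and right subtree.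
\<close>

type_synonym 'a pst = "('a \<times> nat \<times> nat \<times> nat) tree"

definition contents :: "'a pst \<Rightarrow> ('a \<times> nat) list" where
  "contents t = map (\<lambda>(a, k, x, y). (a, k)) (inorder t)"

definition stored :: "'a pst \<Rightarrow> 'a list" where
  "stored t = map fst (contents t)"

fun sums_correct :: "'a pst \<Rightarrow> bool" where
  "sums_correct Leaf = True"
| "sums_correct (Node l (a, k, x, y) r) =
     (sums_correct l \<and> sums_correct r \<and>
      x = sum_list (map snd (contents l)) \<and> y = sum_list (map snd (contents r)))"

definition partial_sum_tree :: "'a pst \<Rightarrow> bool" where
  "partial_sum_tree t \<longleftrightarrow> sums_correct t \<and> distinct (stored t)"

fun total :: "'a pst \<Rightarrow> nat" where
  "total Leaf = 0"
| "total (Node l (a, k, x, y) r) = x + k + y"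

datatype dir = Go_Left | Go_Right

text \<open>
  The descent guided by \<open>\<rho>\<close> returns the sampled element and the path to its node;
  the case of a leaf is not reached when \<open>1 \<le> \<rho> \<le> total t\<close>.
\<close>

fun descend :: "'a pst \<Rightarrow> nat \<Rightarrow> 'a \<times> dir list" where
  "descend Leaf \<rho> = (undefined, [])"
| "descend (Node l (a, k, x, y) r) \<rho> =
     (if \<rho> \<le> x then map_prod id ((#) Go_Left) (descend l \<rho>)
      else if \<rho> \<le> x + k then (a, [])
      else map_prod id ((#) Go_Right) (descend r (\<rho> - (x + k))))"

fun change_weight :: "dir list \<Rightarrow> nat \<Rightarrow> 'a pst \<Rightarrow> 'a pst" where
  "change_weight p w Leaf = Leaf"
| "change_weight [] w (Node l (a, k, x, y) r) = Node l (a, w, x, y) r"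
| "change_weight (Go_Left # p) w (Node l (a, k, x, y) r) =
     (let l' = change_weight p w l in Node l' (a, k, total l', y) r)"
| "change_weight (Go_Right # p) w (Node l (a, k, x, y) r) =
     (let r' = change_weight p w r in Node l (a, k, x, total r') r')"

text \<open>
  A balancing discipline: an invariant \<open>bal\<close> that forces logarithmic height, together with
  an insertion \<open>ins\<close> (which may restructure the tree) that maintains it and whose
  cost \<open>ins_cost\<close> is at most proportional to the depth of the tree. Sampling and changing a
  weight do not restructure the tree and are the fixed functions above. No lower bound on
  \<open>ins_cost\<close> is required.
\<close>

locale balanced_partial_sum_tree =
  fixes bal :: "'a pst \<Rightarrow> bool"
    and ins :: "'a \<Rightarrow> nat \<Rightarrow> 'a pst \<Rightarrow> 'a pst"
    and ins_cost :: "'a \<Rightarrow> nat \<Rightarrow> 'a pst \<Rightarrow> nat"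
  assumes bal_Leaf: "bal Leaf"
    and bal_change_weight: "bal t \<Longrightarrow> bal (change_weight p w t)"
    and bal_height: "\<exists>K. \<forall>t. bal t \<longrightarrow> real (height t) \<le> K * log 2 (real (size t) + 1)"
    and bal_ins:
      "\<lbrakk>bal t; partial_sum_tree t; a \<notin> set (stored t)\<rbrakk> \<Longrightarrow> bal (ins a w t)"
    and sums_correct_ins:
      "\<lbrakk>bal t; partial_sum_tree t; a \<notin> set (stored t)\<rbrakk> \<Longrightarrow> sums_correct (ins a w t)"
    and contents_ins:
      "\<lbrakk>bal t; partial_sum_tree t; a \<notin> set (stored t)\<rbrakk> \<Longrightarrow>
         mset (contents (ins a w t)) = add_mset (a, w) (mset (contents t))"
    and ins_cost_le:
      "\<exists>K. \<forall>t a w. bal t \<longrightarrow> partial_sum_tree t \<longrightarrow> a \<notin> set (stored t) \<longrightarrow>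
         real (ins_cost a w t) \<le> K * (real (height t) + 1)"


section \<open>Random generation of runs\<close>

text \<open>
  \<open>draws\<close> records the random integers drawn so far, \<open>cost\<close> the accumulated cost of the
  operations on the multiset.
\<close>

record 'a config =
  run :: "'a list"
  mtree :: "'a pst"
  draws :: "nat list"
  cost :: nat

type_synonym 'a insertion = "'a \<Rightarrow> nat \<Rightarrow> 'a pst \<Rightarrow> 'a pst"
type_synonym 'a insertion_cost = "'a \<Rightarrow> nat \<Rightarrow> 'a pst \<Rightarrow> nat"

fun insert_all ::
  "'a insertion \<Rightarrow> 'a insertion_cost \<Rightarrow> 'a process list \<Rightarrow> 'a pst \<times> nat \<Rightarrow> 'a pst \<times> nat"
where
  "insert_all ins ins_cost [] (t, c) = (t, c)"
| "insert_all ins ins_cost (s # ss) (t, c) =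
     insert_all ins ins_cost ss
       (ins (act s) (weight s) t, c + ins_cost (act s) (weight s) t)"

definition initial ::
  "'a insertion \<Rightarrow> 'a insertion_cost \<Rightarrow> 'a process \<Rightarrow> 'a config"
where
  "initial ins ins_cost T =
     (let (t, c) = insert_all ins ins_cost [T] (Leaf, 0)
      in \<lparr>run = [], mtree = t, draws = [], cost = c\<rparr>)"

text \<open>
  The path \<open>p\<close> visits \<open>length p + 1\<close> nodes. It is followed twice: once downwards for
  sampling, and once more for updating the sums when the weight is set to \<open>0\<close>.
\<close>

definition advance ::
  "'a insertion \<Rightarrow> 'a insertion_cost \<Rightarrow> 'a process \<Rightarrow> 'a config \<Rightarrow> nat \<Rightarrow> 'a config"
where
  "advance ins ins_cost T S \<rho> =
     (let (a, p) = descend (mtree S) \<rho>;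
          sample_cost = length p + 1;
          change_cost = length p + 1;
          (t, c) = insert_all ins ins_cost (children T a) (change_weight p 0 (mtree S), 0)
      in \<lparr>run = run S @ [a], mtree = t, draws = draws S @ [\<rho>],
          cost = cost S + sample_cost + change_cost + c\<rparr>)"

definition step ::
  "'a insertion \<Rightarrow> 'a insertion_cost \<Rightarrow> 'a process \<Rightarrow> 'a config \<Rightarrow> 'a config pmf"
where
  "step ins ins_cost T S =
     map_pmf (advance ins ins_cost T S) (pmf_of_set {1..total (mtree S)})"

fun steps ::
  "'a insertion \<Rightarrow> 'a insertion_cost \<Rightarrow> 'a process \<Rightarrow> nat \<Rightarrow> 'a config \<Rightarrow> 'a config pmf"
where
  "steps ins ins_cost T 0 S = return_pmf S"
| "steps ins ins_cost T (Suc m) S =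
     bind_pmf (step ins ins_cost T S) (steps ins ins_cost T m)"

definition random_execution ::
  "'a insertion \<Rightarrow> 'a insertion_cost \<Rightarrow> 'a process \<Rightarrow> 'a config pmf"
where
  "random_execution ins ins_cost T =
     steps ins ins_cost T (length (nodes T)) (initial ins ins_cost T)"

definition execution_costs :: "'a insertion \<Rightarrow> 'a insertion_cost \<Rightarrow> nat \<Rightarrow> nat set" where
  "execution_costs ins ins_cost n =
     (\<Union>T \<in> weighted_process_trees n. cost ` set_pmf (random_execution ins ins_cost T))"

definition worst_case_cost :: "'a insertion \<Rightarrow> 'a insertion_cost \<Rightarrow> nat \<Rightarrow> nat" where
  "worst_case_cost ins ins_cost n = Max (execution_costs ins ins_cost n)"


section \<open>A balanced partial sum tree without restructuring\<close>

text \<open>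
  Inserting into the smaller subtree keeps the tree size-balanced, which shows that the
  locale above is inhabited.
\<close>

fun sb_ins :: "'a insertion" where
  "sb_ins a w Leaf = Node Leaf (a, w, 0, 0) Leaf"
| "sb_ins a w (Node l (b, k, x, y) r) =
     (if size l \<le> size r then Node (sb_ins a w l) (b, k, x + w, y) r
      else Node l (b, k, x, y + w) (sb_ins a w r))"

fun sb_ins_cost :: "'a insertion_cost" where
  "sb_ins_cost a w Leaf = 1"
| "sb_ins_cost a w (Node l (b, k, x, y) r) =
     1 + (if size l \<le> size r then sb_ins_cost a w l else sb_ins_cost a w r)"

lemma size_change_weight [simp]: "size (change_weight p w t) = size t"
  by (induction p w t rule: change_weight.induct) (auto simp: Let_def)

lemma wbalanced_change_weight: "wbalanced t \<Longrightarrow> wbalanced (change_weight p w t)"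
  by (induction p w t rule: change_weight.induct) (auto simp: Let_def)

lemma size_sb_ins [simp]: "size (sb_ins a w t) = Suc (size t)"
  by (induction a w t rule: sb_ins.induct) auto

lemma wbalanced_sb_ins: "wbalanced t \<Longrightarrow> wbalanced (sb_ins a w t)"
  by (induction a w t rule: sb_ins.induct) auto

lemma contents_sb_ins: "mset (contents (sb_ins a w t)) = add_mset (a, w) (mset (contents t))"
  by (induction a w t rule: sb_ins.induct) (auto simp: contents_def)

lemma sum_contents_sb_ins:
  "sum_list (map snd (contents (sb_ins a w t))) = sum_list (map snd (contents t)) + w"
proof -
  have "sum_list (map snd (contents u)) = sum_mset (image_mset snd (mset (contents u)))"
    for u :: "'a pst"
    by (metis mset_map sum_mset_sum_list)
  then show ?thesis by (simp add: contents_sb_ins)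
qed

lemma sums_correct_sb_ins: "sums_correct t \<Longrightarrow> sums_correct (sb_ins a w t)"
  by (induction a w t rule: sb_ins.induct) (auto simp: sum_contents_sb_ins, simp add: contents_def)

lemma sb_ins_cost_le: "sb_ins_cost a w t \<le> height t + 1"
  by (induction a w t rule: sb_ins_cost.induct) auto

lemma height_wbalanced:
  assumes "wbalanced t"
  shows "real (height t) \<le> 2 * log 2 (real (size t) + 1)"
proof (cases t)
  case (Node l x r)
  then have "real (size t) + 1 \<ge> 2" by simp
  then have "log 2 (real (size t) + 1) \<ge> log 2 2"
    by (subst log_le_cancel_iff) auto
  then have 1: "log 2 (real (size t) + 1) \<ge> 1" by simp
  have "height t = nat \<lceil>log 2 (real (size t) + 1)\<rceil>"
    using height_acomplete[OF acomplete_if_wbalanced[OF assms]]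
    by (simp add: size1_size add.commute)
  moreover have "\<lceil>log 2 (real (size t) + 1)\<rceil> \<ge> 0" using 1 by linarith
  ultimately have "real (height t) = of_int \<lceil>log 2 (real (size t) + 1)\<rceil>"
    by simp
  also have "\<dots> \<le> log 2 (real (size t) + 1) + 1" by linarith
  finally show ?thesis using 1 by linarith
qed simp

lemma balanced_partial_sum_tree_sb:
  "balanced_partial_sum_tree wbalanced sb_ins (sb_ins_cost :: 'a insertion_cost)"
proof
  show "\<exists>K. \<forall>t :: 'a pst. wbalanced t \<longrightarrow> real (height t) \<le> K * log 2 (real (size t) + 1)"
    using height_wbalanced by blast
  have "real (sb_ins_cost a w t) \<le> 1 * (real (height t) + 1)" for a :: 'a and w t
    using sb_ins_cost_le[of a w t] by simp
  then show "\<exists>K. \<forall>t (a :: 'a) w. wbalanced t \<longrightarrow> partial_sum_tree t \<longrightarrow> a \<notin> set (stored t) \<longrightarrow>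
         real (sb_ins_cost a w t) \<le> K * (real (height t) + 1)"
    by blast
qed (auto simp: wbalanced_change_weight wbalanced_sb_ins contents_sb_ins
    sums_correct_sb_ins partial_sum_tree_def)

end

theory Submission
  imports Defs "HOL-Real_Asymp.Real_Asymp"
begin

text \<open>
  After drawing \<open>p\<close> actions the stored weights sum to \<open>n - p\<close>: an action of weight \<open>|T(a)|\<close> is
  replaced by its children, whose weights sum to \<open>|T(a)| - 1\<close>. Hence a concurrent run has
  probability \<open>(\<Prod>v. |T(v)|) / n!\<close>, which does not depend on the run, so the distribution is
  uniform without appeal to the hook length formula.

  Each step descends once, and each action is inserted once, into a tree of logarithmic height;
  this gives the upper bound. For the lower bound take a star: after the first step the shape of
  the search tree is fixed, and every other action is drawn exactly once, so the cost is at least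
  twice the internal path length of a binary tree with \<open>n\<close> nodes, up to \<open>O(n)\<close>.
\<close>

section \<open>Process trees\<close>

lemma length_nodes_pos [simp]: "length (nodes s) > 0"
  by (cases s) simp

lemma root_in_nodes [simp]: "s \<in> set (nodes s)"
  by (cases s) simp

lemma length_nodes: "length (nodes s) = Suc (\<Sum>c\<leftarrow>subs s. length (nodes c))"
  by (cases s) (simp add: length_concat comp_def)

lemma subs_in_nodes: "s \<in> set (nodes T) \<Longrightarrow> c \<in> set (subs s) \<Longrightarrow> c \<in> set (nodes T)"
proof (induction T)
  case (Process a w ts)
  show ?case
  proof (cases "s = Process a w ts")
    case True
    then show ?thesis using Process.prems by (auto intro: bexI[of _ c])
  next
    case False
    then show ?thesis using Process by auto
  qed
qed

text \<open>Every node other than the root is listed as a child exactly once. Stated for multisets,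
  so that distinctness of the actions passes to the concatenated child lists; unique parents and the
  special role of the root both follow from that.\<close>

lemma mset_actions:
  "mset (actions T) = mset (act T # concat (map (\<lambda>s. map act (subs s)) (nodes T)))"
proof (induction T)
  case (Process a w ts)
  have "mset (concat (map actions ts)) =
      mset (map act ts @ concat (map (\<lambda>t. concat (map (\<lambda>s. map act (subs s)) (nodes t))) ts))"
    using Process by (induction ts) auto
  moreover have "actions (Process a w ts) = a # concat (map actions ts)"
    by (simp add: actions_def[abs_def] map_concat comp_def)
  moreover have "concat (map (\<lambda>s. map act (subs s)) (concat (map nodes us))) =
      concat (map (\<lambda>t. concat (map (\<lambda>s. map act (subs s)) (nodes t))) us)" for us :: "'a process list"
    by (induction us) auto
  ultimately show ?case by simp
qed

lemma set_actions: "set (actions T) = insert (act T) (\<Union>s\<in>set (nodes T). act ` set (subs s))"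
  using arg_cong[OF mset_actions[of T], of set_mset] by simp

section \<open>The node of an action, and runs grown one action at a time\<close>

definition node_at :: "'a process \<Rightarrow> 'a \<Rightarrow> 'a process" where
  "node_at T a = the (find (\<lambda>s. act s = a) (nodes T))"

lemma children_eq: "children T a = subs (node_at T a)"
  by (simp add: children_def node_at_def)

lemma node_at:
  assumes "a \<in> set (actions T)"
  shows "node_at T a \<in> set (nodes T)" and "act (node_at T a) = a"
proof -
  have "find (\<lambda>s. act s = a) (nodes T) \<noteq> None"
    using assms by (auto simp: find_None_iff actions_def)
  then obtain s where s: "find (\<lambda>s. act s = a) (nodes T) = Some s" by auto
  then have "s \<in> set (nodes T) \<and> act s = a" by (auto simp: find_Some_iff)
  then show "node_at T a \<in> set (nodes T)" and "act (node_at T a) = a"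
    by (auto simp: node_at_def s)
qed

text \<open>The actions that have entered the multiset once those in \<open>X\<close> have been
  drawn. Drawn actions are included, since they stay stored with weight 0.\<close>

definition revealed :: "'a process \<Rightarrow> 'a set \<Rightarrow> 'a set" where
  "revealed T X = insert (act T) (\<Union>a\<in>X. act ` set (children T a))"

text \<open>The prefix form of the order condition: it follows the algorithm and can be extended by
  one action. For distinct actions, the partial runs of full length are the concurrent runs.\<close>

definition partial_run :: "'a process \<Rightarrow> 'a list \<Rightarrow> bool" where
  "partial_run T \<sigma> \<longleftrightarrow>
     (\<forall>i<length \<sigma>. \<sigma> ! i \<in> revealed T (set (take i \<sigma>)) - set (take i \<sigma>))"

lemma partial_run_Nil [simp]: "partial_run T []"
  by (simp add: partial_run_def)

lemma partial_run_snoc: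
  "partial_run T (\<sigma> @ [a]) \<longleftrightarrow> partial_run T \<sigma> \<and> a \<in> revealed T (set \<sigma>) - set \<sigma>"
  by (auto simp: partial_run_def nth_append less_Suc_eq)

lemma partial_run_appendD: "partial_run T (\<sigma> @ \<tau>) \<Longrightarrow> partial_run T \<sigma>"
  by (induction \<tau> rule: rev_induct) (simp_all flip: append_assoc add: partial_run_snoc)

lemma children_in_actions:
  assumes "a \<in> set (actions T)" "c \<in> set (children T a)"
  shows "c \<in> set (nodes T)" and "act c \<in> set (actions T)"
proof -
  show "c \<in> set (nodes T)"
    using assms subs_in_nodes node_at by (metis children_eq)
  then show "act c \<in> set (actions T)" by (simp add: actions_def)
qed

lemma revealed_subset: "X \<subseteq> set (actions T) \<Longrightarrow> revealed T X \<subseteq> set (actions T)"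
  unfolding revealed_def
  by (intro insert_subsetI UN_least image_subsetI)
    (simp add: set_actions, blast intro: children_in_actions(2))

lemma partial_run_subset: "partial_run T \<sigma> \<Longrightarrow> set \<sigma> \<subseteq> set (actions T)"
proof (induction \<sigma> rule: rev_induct)
  case (snoc a \<sigma>)
  then show ?case using revealed_subset by (auto simp: partial_run_snoc)
qed simp

lemma partial_run_distinct: "partial_run T \<sigma> \<Longrightarrow> distinct \<sigma>"
  by (induction \<sigma> rule: rev_induct) (auto simp: partial_run_snoc)

section \<open>Unique parents, and partial runs versus concurrent runs\<close>

locale distinct_process =
  fixes T :: "'a process"
  assumes distinct_actions: "distinct (actions T)"
begin

lemma distinct_children: "distinct (act T # concat (map (\<lambda>s. map act (subs s)) (nodes T)))"
  using distinct_actions mset_actions mset_eq_imp_distinct_iff by metis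

lemma node_at_act [simp]: "s \<in> set (nodes T) \<Longrightarrow> node_at T (act s) = s"
  using node_at[of "act s" T] distinct_actions
  by (auto simp: actions_def distinct_map dest: inj_onD)

lemma children_act: "s \<in> set (nodes T) \<Longrightarrow> children T (act s) = subs s"
  by (simp add: children_eq)

lemma distinct_act_subs: "s \<in> set (nodes T) \<Longrightarrow> distinct (map act (subs s))"
  using distinct_children by (auto simp: distinct_concat_iff)

lemma root_not_child:
  assumes "s \<in> set (nodes T)" "c \<in> set (subs s)"
  shows "act c \<noteq> act T"
proof -
  have "act T \<notin> act ` set (subs s)" using distinct_children assms(1) by simp
  then show ?thesis using assms(2) by (metis imageI)
qed

text \<open>An action occurs only once in the concatenation of all child lists, so it cannot lie in
  the lists of two nodes.\<close>

lemma unique_parent: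
  assumes "s \<in> set (nodes T)" "c \<in> set (subs s)" "s' \<in> set (nodes T)" "c' \<in> set (subs s')"
    and "act c = act c'"
  shows "s = s'"
proof -
  have "distinct (concat (map (\<lambda>s. map act (subs s)) us)) \<Longrightarrow> s \<in> set us \<Longrightarrow> s' \<in> set us \<Longrightarrow> s = s'" for us
  proof (induction us)
    case (Cons u us)
    have "act c \<in> act ` set (subs s)" "act c \<in> act ` set (subs s')" using assms(2,4,5) by (simp_all, metis imageI)
    then show ?case using Cons by auto
  qed simp
  then show ?thesis using distinct_children assms(1,3) unfolding distinct.simps(2) by blast
qed

text \<open>A child is revealed only by drawing its unique parent, here \<open>a\<close>, which is
  still outside \<open>X\<close>. This yields the freshness that insertions require.\<close>

lemma children_fresh:
  assumes "X \<subseteq> set (actions T)" "a \<in> set (actions T)" "a \<notin> X" "c \<in> set (children T a)"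
  shows "act c \<notin> revealed T X"
proof
  assume "act c \<in> revealed T X"
  moreover have "act c \<noteq> act T"
    using assms root_not_child[OF node_at(1)] by (metis children_eq)
  ultimately obtain b c' where b: "b \<in> X" "c' \<in> set (children T b)" "act c = act c'"
    by (auto simp: revealed_def)
  then have "node_at T a = node_at T b"
    using unique_parent[OF node_at(1) _ node_at(1)] assms by (metis children_eq subsetD)
  then have "a = b" using node_at(2) assms b by (metis subsetD)
  then show False using b assms by simp
qed

lemma partial_run_iff_concurrent_run:
  "partial_run T \<sigma> \<and> length \<sigma> = length (nodes T) \<longleftrightarrow> \<sigma> \<in> concurrent_runs T"
proof
  assume *: "partial_run T \<sigma> \<and> length \<sigma> = length (nodes T)"
  then have d: "distinct \<sigma>" and sub: "set \<sigma> \<subseteq> set (actions T)"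
    using partial_run_distinct partial_run_subset by blast+
  \<comment> \<open>Distinct entries, all of them actions and as many as there are nodes: no action
    can be missing.\<close>
  have "card (set \<sigma>) = card (set (actions T))"
    using * distinct_card[OF d] distinct_card[OF distinct_actions] by (simp add: actions_def)
  then have set: "set \<sigma> = set (actions T)"
    using sub by (simp add: card_subset_eq)
  have "i < j" if s: "s \<in> set (nodes T)" "c \<in> set (subs s)" "i < length \<sigma>" "j < length \<sigma>"
      "\<sigma> ! i = act s" "\<sigma> ! j = act c" for s c i j
  proof -
    \<comment> \<open>Some \<open>b\<close> before position \<open>j\<close> revealed
      \<open>c\<close>; uniqueness of parents identifies \<open>b\<close> with \<open>act s\<close>,
      and distinctness puts its occurrence at position \<open>i\<close>.\<close>
    have "act c \<in> revealed T (set (take j \<sigma>))" using * s by (auto simp: partial_run_def)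
    then obtain b c' where b: "b \<in> set (take j \<sigma>)" "c' \<in> set (children T b)" "act c = act c'"
      using root_not_child[OF s(1,2)] by (auto simp: revealed_def)
    have bA: "b \<in> set (actions T)" using b(1) set by (auto dest: in_set_takeD)
    have "s = node_at T b"
      using unique_parent[OF s(1,2) node_at(1)[OF bA] _ b(3)] b(2) by (simp add: children_eq)
    then have "act s = b" using node_at(2)[OF bA] by simp
    then have "\<sigma> ! i \<in> set (take j \<sigma>)" using b s by simp
    then obtain k where "k < j" "k < length \<sigma>" "\<sigma> ! k = \<sigma> ! i" by (auto simp: in_set_conv_nth)
    then have "k = i" using d s(3) by (metis nth_eq_iff_index_eq)
    then show ?thesis using \<open>k < j\<close> by simp
  qed
  then show "\<sigma> \<in> concurrent_runs T" using d set by (auto simp: concurrent_runs_def)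
next
  assume *: "\<sigma> \<in> concurrent_runs T"
  then have d: "distinct \<sigma>" and set: "set \<sigma> = set (actions T)" by (auto simp: concurrent_runs_def)
  have "\<sigma> ! j \<in> revealed T (set (take j \<sigma>)) - set (take j \<sigma>)" if j: "j < length \<sigma>" for j
  proof
    show "\<sigma> ! j \<notin> set (take j \<sigma>)"
      using d j by (auto simp: in_set_conv_nth nth_eq_iff_index_eq)
    have "\<sigma> ! j \<in> set (actions T)" using j set nth_mem by metis
    then consider "\<sigma> ! j = act T" |
      s c where "s \<in> set (nodes T)" "c \<in> set (subs s)" "\<sigma> ! j = act c"
      unfolding set_actions by auto
    then show "\<sigma> ! j \<in> revealed T (set (take j \<sigma>))"
    proof cases
      case (2 s c)
      have "act s \<in> set \<sigma>" using 2 set by (simp add: actions_def)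
      then obtain i where i: "i < length \<sigma>" "\<sigma> ! i = act s" by (auto simp: in_set_conv_nth)
      then have "i < j" using * 2 j unfolding concurrent_runs_def by blast
      then have "act s \<in> set (take j \<sigma>)" using i j by (auto simp: in_set_conv_nth)
      moreover have "c \<in> set (children T (act s))" using 2 by (simp add: children_act)
      ultimately show ?thesis unfolding revealed_def 2(3) by blast
    qed (simp add: revealed_def)
  qed
  moreover have "length \<sigma> = length (nodes T)"
    using distinct_card[OF d] distinct_card[OF distinct_actions] set by (simp add: actions_def)
  ultimately show "partial_run T \<sigma> \<and> length \<sigma> = length (nodes T)"
    by (simp add: partial_run_def)
qed

end

lemma finite_concurrent_runs: "finite (concurrent_runs T)"
  by (rule finite_subset[OF _ finite_subset_distinct[of "set (actions T)"]])
    (auto simp: concurrent_runs_def)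


section \<open>Partial sum trees\<close>

lemma contents_simps [simp]:
  "contents Leaf = []"
  "contents (Node l (a, k, x, y) r) = contents l @ (a, k) # contents r"
  by (simp_all add: contents_def)

lemma length_contents: "length (contents t) = size t"
  by (simp add: contents_def)

lemma total_eq: "sums_correct t \<Longrightarrow> total t = sum_list (map snd (contents t))"
  by (induction t rule: total.induct) auto

text \<open>Elements in symmetric order with their depths. The root has depth 1, so a depth is the
  number of nodes visited on the way to the element.\<close>

fun levels :: "'a pst \<Rightarrow> ('a \<times> nat) list" where
  "levels Leaf = []"
| "levels (Node l (a, k, x, y) r) =
     map (apsnd Suc) (levels l) @ (a, 1) # map (apsnd Suc) (levels r)"

lemma map_fst_levels: "map fst (levels t) = stored t"
  by (induction t rule: levels.induct) (auto simp: stored_def)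

lemma levels_change_weight [simp]: "levels (change_weight p w t) = levels t"
  by (induction p w t rule: change_weight.induct) (auto simp: Let_def)

lemma levels_le_height: "(a, d) \<in> set (levels t) \<Longrightarrow> d \<le> height t"
  by (induction t arbitrary: d rule: levels.induct) fastforce+

text \<open>In symmetric order the weights cut \<open>{1..total t}\<close> into consecutive
  intervals, and the descent finds the one containing \<rho>. The sampled element, the effect of the
  update and the cost all depend on the same path, so one induction establishes them
  together.\<close>

lemma descend_cases:
  assumes "sums_correct t" "\<rho> \<in> {1..total t}" "descend t \<rho> = (a, p)"
  shows "\<exists>xs k ys. contents t = xs @ (a, k) # ys \<and>
           sum_list (map snd xs) < \<rho> \<and> \<rho> \<le> sum_list (map snd xs) + k \<and>
           (\<forall>w. contents (change_weight p w t) = xs @ (a, w) # ys \<and>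
                sums_correct (change_weight p w t)) \<and>
           (a, length p + 1) \<in> set (levels t)"
  using assms
proof (induction t \<rho> arbitrary: p rule: descend.induct)
  case (2 l b k x y r \<rho>)
  note sc = "2.prems"(1)
  consider (l) "\<rho> \<le> x" | (m) "x < \<rho>" "\<rho> \<le> x + k" | (r) "x + k < \<rho>" by linarith
  then show ?case
  proof cases
    case l
    then obtain q where q: "descend l \<rho> = (a, q)" "p = Go_Left # q"
      using "2.prems" by (cases "descend l \<rho>") auto
    obtain xs k' ys where *: "contents l = xs @ (a, k') # ys"
       "sum_list (map snd xs) < \<rho>" "\<rho> \<le> sum_list (map snd xs) + k'"
       "\<And>w. contents (change_weight q w l) = xs @ (a, w) # ys"
       "\<And>w. sums_correct (change_weight q w l)" "(a, length q + 1) \<in> set (levels l)"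
      using "2.IH"(1)[OF l, of q] l "2.prems" q(1) total_eq[of l] by auto
    moreover have "(a, length p + 1) \<in> apsnd Suc ` set (levels l)"
      using imageI[OF *(6), of "apsnd Suc"] q by simp
    ultimately show ?thesis
      using q sc by (intro exI[of _ xs] exI[of _ k'] exI[of _ "ys @ (b, k) # contents r"])
        (simp add: Let_def total_eq)
  next
    case m
    then show ?thesis using "2.prems"
      by (intro exI[of _ "contents l"] exI[of _ k] exI[of _ "contents r"]) auto
  next
    case r
    then obtain q where q: "descend r (\<rho> - (x + k)) = (a, q)" "p = Go_Right # q"
      using "2.prems" by (cases "descend r (\<rho> - (x + k))") auto
    have "sums_correct r" "\<rho> - (x + k) \<in> {1..total r}"
      using r "2.prems"(1,2) total_eq[of r] by auto
    then obtain xs k' ys where *: "contents r = xs @ (a, k') # ys"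
       "sum_list (map snd xs) < \<rho> - (x + k)" "\<rho> - (x + k) \<le> sum_list (map snd xs) + k'"
       "\<And>w. contents (change_weight q w r) = xs @ (a, w) # ys"
       "\<And>w. sums_correct (change_weight q w r)" "(a, length q + 1) \<in> set (levels r)"
      using "2.IH"(2)[of q] r q(1) by auto
    moreover have "(a, length p + 1) \<in> apsnd Suc ` set (levels r)"
      using imageI[OF *(6), of "apsnd Suc"] q by simp
    moreover have "x = sum_list (map snd (contents l))" using sc by simp
    ultimately show ?thesis
      \<comment> \<open>Subtracting \<open>x + k\<close> before going right is compensated by the
        prefix \<open>contents l\<close> and \<open>(b, k)\<close>, whose weights sum to
        \<open>x + k\<close>.\<close>
      using q sc r by (intro exI[of _ "contents l @ (b, k) # xs"] exI[of _ k'] exI[of _ ys])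
        (simp add: Let_def total_eq, linarith)
  qed
qed simp

lemma distinct_split_unique:
  assumes "distinct (map fst (xs @ (a, k) # ys))" "xs @ (a, k) # ys = xs' @ (a, k') # ys'"
  shows "xs = xs' \<and> k = k' \<and> ys = ys'"
  using assms
proof (induction xs arbitrary: xs')
  case Nil
  then show ?case by (cases xs') auto
next
  case (Cons z xs)
  from Cons.prems have "xs' \<noteq> []" by auto
  then obtain zs where zs: "xs' = z # zs" "xs @ (a, k) # ys = zs @ (a, k') # ys'"
    using Cons.prems by (cases xs') auto
  moreover have "distinct (map fst (xs @ (a, k) # ys))" using Cons.prems(1) by simp
  ultimately show ?case using Cons.IH by blast
qed

text \<open>Intervals between successive prefix sums are disjoint. The induction removes the first
  entry and shifts \<rho> by its value.\<close>

lemma split_intervals_disjoint: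
  fixes f :: "'b \<Rightarrow> nat"
  assumes "xs @ u # ys = xs' @ u' # ys'"
    and "sum_list (map f xs) < \<rho>" "\<rho> \<le> sum_list (map f xs) + f u"
    and "sum_list (map f xs') < \<rho>" "\<rho> \<le> sum_list (map f xs') + f u'"
  shows "u = u'"
  using assms
proof (induction xs arbitrary: xs' \<rho>)
  case Nil
  then show ?case by (cases xs') auto
next
  case (Cons z xs)
  then show ?case
  proof (cases xs')
    case (Cons z' zs)
    then show ?thesis
      using Cons.IH[of zs "\<rho> - f z"] Cons.prems by auto
  qed auto
qed

text \<open>An element of weight \<open>k\<close> is returned for exactly \<open>k\<close> values of
  \<rho>, so a uniform \<rho> samples it with probability \<open>k / total t\<close>.\<close>

lemma card_descend:
  assumes t: "partial_sum_tree t" and a: "(a, k) \<in> set (contents t)"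
  shows "card {\<rho> \<in> {1..total t}. fst (descend t \<rho>) = a} = k"
proof -
  from a obtain xs ys where eq: "contents t = xs @ (a, k) # ys" by (meson split_list)
  have sc: "sums_correct t" and d: "distinct (map fst (contents t))"
    using t by (auto simp: partial_sum_tree_def stored_def)
  let ?s = "sum_list (map snd xs)"
  have "{\<rho> \<in> {1..total t}. fst (descend t \<rho>) = a} = {?s<..?s + k}"
  proof (intro equalityI subsetI)
    fix \<rho> assume "\<rho> \<in> {\<rho> \<in> {1..total t}. fst (descend t \<rho>) = a}"
    then obtain p where \<rho>: "\<rho> \<in> {1..total t}" "descend t \<rho> = (a, p)"
      by (cases "descend t \<rho>") auto
    obtain xs' k' ys' where *: "contents t = xs' @ (a, k') # ys'"
        "sum_list (map snd xs') < \<rho>" "\<rho> \<le> sum_list (map snd xs') + k'"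
      using descend_cases[OF sc \<rho>] by blast
    have "xs = xs' \<and> k = k'" using distinct_split_unique[OF d[unfolded eq] trans[OF eq[symmetric] *(1)]] by simp
    then show "\<rho> \<in> {?s<..?s + k}" using * by simp
  next
    fix \<rho> assume i: "\<rho> \<in> {?s<..?s + k}"
    then have \<rho>: "\<rho> \<in> {1..total t}" using eq by (auto simp: total_eq[OF sc])
    obtain b p where bp: "descend t \<rho> = (b, p)" by fastforce
    obtain xs' k' ys' where *: "contents t = xs' @ (b, k') # ys'"
        "sum_list (map snd xs') < \<rho>" "\<rho> \<le> sum_list (map snd xs') + k'"
      using descend_cases[OF sc \<rho> bp] by blast
    have "(a, k) = (b, k')"
      by (rule split_intervals_disjoint[of xs _ ys xs' _ ys' snd \<rho>]) (use eq * i in auto)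
    then show "\<rho> \<in> {\<rho> \<in> {1..total t}. fst (descend t \<rho>) = a}" using \<rho> bp by simp
  qed
  then show ?thesis by simp
qed

section \<open>Lower bound on path lengths in binary trees\<close>

lemma log_convex:
  fixes a b :: real
  assumes "a > 0" "b > 0"
  shows "(a + b) * log 2 (a + b) \<le> a * log 2 a + b * log 2 b + (a + b)"
proof -
  \<comment> \<open>Convexity of x ln x at the mean \<open>m\<close> of \<open>a\<close> and
    \<open>b\<close>, derived from ln z \<le> z - 1. The resulting bounds \<open>m - a\<close> and
    \<open>m - b\<close> cancel; halving at the mean contributes the summand \<open>a + b\<close>,
    because log 2 of 2 is 1.\<close>
  have 1: "ln (u / c) \<le> u / c - 1" if "u > 0" "c > 0" for u c :: real
    using ln_le_minus_one[of "u / c"] that by simp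
  define m where "m = (a + b) / 2"
  have m: "m > 0" using assms by (simp add: m_def)
  have "a * ln (m / a) \<le> a * (m / a - 1)" "b * ln (m / b) \<le> b * (m / b - 1)"
    using 1[OF m] assms by (auto intro: mult_left_mono)
  moreover have "a * (m / a - 1) = m - a" "b * (m / b - 1) = m - b"
    using assms by (auto simp: field_simps)
  moreover have "m + m = a + b" by (simp add: m_def)
  ultimately have "a * ln (m / a) + b * ln (m / b) \<le> 0"
    by linarith
  moreover have "ln (m / a) = ln (a + b) - ln 2 - ln a" "ln (m / b) = ln (a + b) - ln 2 - ln b"
    using assms by (auto simp: m_def ln_div ln_mult)
  ultimately have "(a + b) * ln (a + b) \<le> a * ln a + b * ln b + (a + b) * ln 2"
    by (simp add: algebra_simps)
  then have "(a + b) * ln (a + b) / ln 2 \<le> (a * ln a + b * ln b + (a + b) * ln 2) / ln 2"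
    by (intro divide_right_mono) auto
  then show ?thesis by (simp add: log_def add_divide_distrib)
qed

lemma sum_list_map_Suc: "sum_list (map (\<lambda>z. Suc (f z)) zs) = sum_list (map f zs) + length zs"
  by (induction zs) auto

lemma length_levels: "length (levels t) = size t"
  by (induction t rule: levels.induct) auto

text \<open>
  The sum of the levels plus the size is the external path length, which is minimal for
  perfectly balanced trees because \<open>x log x\<close> is convex.
\<close>

lemma sum_levels_ge:
  "(real (size t) + 1) * log 2 (real (size t) + 1) \<le>
     real (sum_list (map snd (levels t))) + real (size t)"
proof (induction t rule: levels.induct)
  case (2 l a k x y r)
  have "sum_list (map snd (levels (Node l (a, k, x, y) r))) =
      sum_list (map snd (levels l)) + size l + sum_list (map snd (levels r)) + size r + 1"
    by (simp add: comp_def sum_list_map_Suc length_levels)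
  \<comment> \<open>The two arguments of the convexity bound are the numbers of leaves of the
    subtrees.\<close>
  moreover have "(real (size l) + 1 + (real (size r) + 1)) * log 2 (real (size l) + 1 + (real (size r) + 1))
      \<le> (real (size l) + 1) * log 2 (real (size l) + 1) +
        (real (size r) + 1) * log 2 (real (size r) + 1) + (real (size l) + 1 + (real (size r) + 1))"
    by (rule log_convex) auto
  ultimately show ?case using 2 by (simp add: add_ac)
qed simp

section \<open>Balanced insertions\<close>

context balanced_partial_sum_tree
begin

text \<open>One constant for both descents and insertions, in terms of the number of stored
  elements. The summand 1 beside the logarithm keeps the bound meaningful for the empty tree, where
  the logarithm is 0.\<close>

definition cost_factor :: "real \<Rightarrow> bool" where
  "cost_factor K \<longleftrightarrow> K \<ge> 0 \<and>
     (\<forall>t. bal t \<longrightarrow> real (height t) + 1 \<le> K * (log 2 (real (size t) + 1) + 1)) \<and>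
     (\<forall>t a w. bal t \<longrightarrow> partial_sum_tree t \<longrightarrow> a \<notin> set (stored t) \<longrightarrow>
        real (ins_cost a w t) \<le> K * (log 2 (real (size t) + 1) + 1))"

lemma cost_factor_exists: "\<exists>K. cost_factor K"
proof -
  obtain K1 where K1: "\<And>t. bal t \<Longrightarrow> real (height t) \<le> K1 * log 2 (real (size t) + 1)"
    using bal_height by blast
  obtain K2 where K2: "\<And>t a w. bal t \<Longrightarrow> partial_sum_tree t \<Longrightarrow> a \<notin> set (stored t) \<Longrightarrow>
      real (ins_cost a w t) \<le> K2 * (real (height t) + 1)"
    using ins_cost_le by blast
  \<comment> \<open>The given constants may be negative, hence the absolute values; the additional 1
    pays for the height plus one.\<close>
  define A where "A = \<bar>K1\<bar> + 1"
  define L where "L = (\<lambda>t :: 'a pst. log 2 (real (size t) + 1))"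
  have L0: "L t \<ge> 0" for t by (simp add: L_def)
  have h: "real (height t) + 1 \<le> A * (L t + 1)" if "bal t" for t
  proof -
    have "K1 * L t \<le> \<bar>K1\<bar> * L t" using L0 by (intro mult_right_mono) auto
    moreover have "real (height t) \<le> K1 * L t" using K1[OF that] by (simp add: L_def)
    moreover have "A * (L t + 1) = \<bar>K1\<bar> * L t + \<bar>K1\<bar> + L t + 1" by (simp add: A_def algebra_simps)
    ultimately show ?thesis using L0[of t] by linarith
  qed
  have i: "real (ins_cost a w t) \<le> \<bar>K2\<bar> * (A * (L t + 1))"
    if "bal t" "partial_sum_tree t" "a \<notin> set (stored t)" for a w t
  proof -
    have "real (ins_cost a w t) \<le> K2 * (real (height t) + 1)" using K2 that by blast
    also have "\<dots> \<le> \<bar>K2\<bar> * (real (height t) + 1)" by (intro mult_right_mono) auto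
    also have "\<dots> \<le> \<bar>K2\<bar> * (A * (L t + 1))" using h[OF that(1)] by (intro mult_left_mono) auto
    finally show ?thesis .
  qed
  have "A \<ge> 0" by (simp add: A_def)
  then have "0 \<le> A * (L t + 1)" "0 \<le> \<bar>K2\<bar> * (A * (L t + 1))" for t using L0[of t] by simp_all
  then have "real (height t) + 1 \<le> (A + \<bar>K2\<bar> * A) * (L t + 1)" if "bal t" for t
    using h[OF that] by (simp add: distrib_right mult.assoc add_increasing2)
  moreover have "real (ins_cost a w t) \<le> (A + \<bar>K2\<bar> * A) * (L t + 1)"
    if "bal t" "partial_sum_tree t" "a \<notin> set (stored t)" for a w t
    using i[OF that] \<open>\<And>t. 0 \<le> A * (L t + 1)\<close>[of t]
    by (simp add: distrib_right mult.assoc add_increasing)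
  ultimately have "cost_factor (A + \<bar>K2\<bar> * A)"
    using \<open>A \<ge> 0\<close> by (auto simp: cost_factor_def L_def)
  then show ?thesis by blast
qed

lemma ins_spec:
  assumes "bal t" "partial_sum_tree t" "a \<notin> set (stored t)"
  shows "bal (ins a w t)" and "partial_sum_tree (ins a w t)"
    and "mset (contents (ins a w t)) = add_mset (a, w) (mset (contents t))"
    and "set (stored (ins a w t)) = insert a (set (stored t))"
    and "size (ins a w t) = Suc (size t)"
proof -
  show c: "mset (contents (ins a w t)) = add_mset (a, w) (mset (contents t))"
    using contents_ins[OF assms] .
  have s: "mset (stored (ins a w t)) = mset (a # stored t)"
    using arg_cong[OF c, of "image_mset fst"] by (simp add: stored_def)
  show "bal (ins a w t)" using bal_ins[OF assms] .
  have "distinct (stored (ins a w t))"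
    using mset_eq_imp_distinct_iff[OF s] assms by (simp add: partial_sum_tree_def)
  then show "partial_sum_tree (ins a w t)"
    using sums_correct_ins[OF assms] by (simp add: partial_sum_tree_def)
  show "set (stored (ins a w t)) = insert a (set (stored t))"
    using mset_eq_setD[OF s] by simp
  show "size (ins a w t) = Suc (size t)"
    using arg_cong[OF c, of size] by (simp add: length_contents)
qed

lemma insert_all_spec:
  assumes "bal t" "partial_sum_tree t"
    and "distinct (map act ss)" "act ` set ss \<inter> set (stored t) = {}"
    and "insert_all ins ins_cost ss (t, c) = (t', c')"
  shows "bal t' \<and> partial_sum_tree t' \<and>
    mset (contents t') = mset (contents t) + mset (map (\<lambda>s. (act s, weight s)) ss)"
  using assms
proof (induction ss arbitrary: t c)
  case (Cons s ss)
  have s: "act s \<notin> set (stored t)" using Cons.prems by auto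
  note i = ins_spec[OF Cons.prems(1,2) s, of "weight s"]
  show ?case
    using Cons.IH[OF i(1,2), of "c + ins_cost (act s) (weight s) t"] Cons.prems i(3,4) by auto
qed simp

text \<open>\<open>N\<close> bounds the final size and hence every intermediate size, so
  monotonicity of the logarithm gives the same bound for each insertion.\<close>

lemma insert_all_cost:
  assumes K: "cost_factor K" and "bal t" "partial_sum_tree t"
    and "distinct (map act ss)" "act ` set ss \<inter> set (stored t) = {}"
    and "insert_all ins ins_cost ss (t, c) = (t', c')" and "size t + length ss \<le> N"
  shows "real c' \<le> real c + K * (log 2 (real N + 1) + 1) * real (length ss)"
  using assms(2-)
proof (induction ss arbitrary: t c)
  case (Cons s ss)
  have s: "act s \<notin> set (stored t)" using Cons.prems by auto
  note i = ins_spec[OF Cons.prems(1,2) s, of "weight s"]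
  have "real (ins_cost (act s) (weight s) t) \<le> K * (log 2 (real (size t) + 1) + 1)"
    using K Cons.prems s by (auto simp: cost_factor_def)
  also have "\<dots> \<le> K * (log 2 (real N + 1) + 1)"
    using K Cons.prems by (intro mult_left_mono) (auto simp: cost_factor_def)
  finally have 1: "real (ins_cost (act s) (weight s) t) \<le> K * (log 2 (real N + 1) + 1)" .
  have "real c' \<le> real (c + ins_cost (act s) (weight s) t) +
      K * (log 2 (real N + 1) + 1) * real (length ss)"
    using Cons.IH[OF i(1,2), of "c + ins_cost (act s) (weight s) t"] Cons.prems i(4,5) by auto
  then show ?case using 1 by (simp add: algebra_simps)
qed simp

end


section \<open>Invariants of the random generation\<close>

lemma sum_list_mset: "sum_list (map f xs) = sum_mset (image_mset f (mset xs))"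
  by (metis mset_map sum_mset_sum_list)

text \<open>The index of \<open>P\<close> is the number of draws still to come. A positive total
  makes the range of the draw nonempty, so that its uniform distribution has the expected
  support.\<close>

lemma steps_invariant:
  assumes "P m S"
    and "\<And>m S. P (Suc m) S \<Longrightarrow> total (mtree S) > 0"
    and "\<And>m S \<rho>. P (Suc m) S \<Longrightarrow> \<rho> \<in> {1..total (mtree S)} \<Longrightarrow> P m (advance ins ins_cost T S \<rho>)"
    and "S' \<in> set_pmf (steps ins ins_cost T m S)"
  shows "P 0 S'"
  using assms(1,4)
proof (induction m arbitrary: S)
  case (Suc m)
  have "set_pmf (pmf_of_set {1..total (mtree S)}) = {1..total (mtree S)}"
    using assms(2)[OF Suc.prems(1)] by (intro set_pmf_of_set) auto
  then obtain \<rho> where "\<rho> \<in> {1..total (mtree S)}"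
      "S' \<in> set_pmf (steps ins ins_cost T m (advance ins ins_cost T S \<rho>))"
    using Suc.prems(2) by (auto simp: step_def)
  then show ?case using Suc.IH assms(3)[OF Suc.prems(1)] by blast
qed simp

lemma run_advance: "run (advance ins ins_cost T S \<rho>) = run S @ [fst (descend (mtree S) \<rho>)]"
  by (simp add: advance_def split: prod.split)

text \<open>Drawn actions are never revised; this excludes the draws that disagree with a prescribed
  run.\<close>

lemma run_steps:
  assumes "S' \<in> set_pmf (steps ins ins_cost T m S)"
  shows "\<exists>\<tau>. run S' = run S @ \<tau>"
  using assms
proof (induction m arbitrary: S)
  case (Suc m)
  then obtain \<rho> where "S' \<in> set_pmf (steps ins ins_cost T m (advance ins ins_cost T S \<rho>))"
    by (auto simp: step_def)
  then show ?case using Suc.IH by (fastforce simp: run_advance)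
qed simp

lemma partial_run_subset_revealed: "partial_run T \<sigma> \<Longrightarrow> set \<sigma> \<subseteq> revealed T (set \<sigma>)"
  by (induction \<sigma> rule: rev_induct) (auto simp: partial_run_snoc revealed_def)

section \<open>Soundness of the configurations for a fixed process tree\<close>

locale random_generation = balanced_partial_sum_tree bal ins ins_cost
  for bal :: "'a pst \<Rightarrow> bool" and ins ins_cost +
  fixes T :: "'a process" and n :: nat
  assumes T: "T \<in> weighted_process_trees n"

sublocale random_generation \<subseteq> distinct_process T
  using T by unfold_locales (simp add: weighted_process_trees_def)

context random_generation
begin

lemma length_nodes_T: "length (nodes T) = n"
  and weight_eq: "s \<in> set (nodes T) \<Longrightarrow> weight s = length (nodes s)"
  using T by (auto simp: weighted_process_trees_def)

lemma card_actions: "card (set (actions T)) = n"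
  using distinct_card[OF distinct_actions] length_nodes_T by (simp add: actions_def)

abbreviation subtree_size :: "'a \<Rightarrow> nat" where
  "subtree_size a \<equiv> length (nodes (node_at T a))"

text \<open>Drawn actions remain in the tree with weight 0, so the stored set is all of
  \<open>revealed\<close>. The last conjunct is the conservation law that fixes the denominator of
  every sampling probability.\<close>

definition sound :: "'a config \<Rightarrow> bool" where
  "sound S \<longleftrightarrow> bal (mtree S) \<and> partial_sum_tree (mtree S) \<and> partial_run T (run S) \<and>
     set (stored (mtree S)) = revealed T (set (run S)) \<and>
     (\<forall>(a, k) \<in> set (contents (mtree S)). k = (if a \<in> set (run S) then 0 else subtree_size a)) \<and>
     total (mtree S) + length (run S) = n"

lemma sound_size:
  assumes "sound S"
  shows "size (mtree S) \<le> n"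
proof -
  have d: "distinct (stored (mtree S))" and sub: "set (stored (mtree S)) \<subseteq> set (actions T)"
    using assms revealed_subset[OF partial_run_subset]
    by (auto simp: sound_def partial_sum_tree_def)
  have "length (stored (mtree S)) \<le> n"
    using card_mono[OF _ sub] distinct_card[OF d] card_actions by simp
  then show ?thesis by (simp add: stored_def length_contents)
qed

lemma sound_run:
  assumes "sound S" "length (run S) = n"
  shows "run S \<in> concurrent_runs T"
  using assms partial_run_iff_concurrent_run length_nodes_T by (auto simp: sound_def)

lemma initial_sound:
  assumes "insert_all ins ins_cost [T] (Leaf, 0) = (t, c)"
  shows "initial ins ins_cost T = \<lparr>run = [], mtree = t, draws = [], cost = c\<rparr>"
    and "sound (initial ins ins_cost T)"
    and "size t = 1"
proof -
  show i: "initial ins ins_cost T = \<lparr>run = [], mtree = t, draws = [], cost = c\<rparr>"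
    using assms by (simp add: initial_def)
  have "bal t \<and> partial_sum_tree t \<and>
      mset (contents t) = mset (contents Leaf) + mset (map (\<lambda>s. (act s, weight s)) [T])"
    by (rule insert_all_spec[OF _ _ _ _ assms])
      (auto simp: bal_Leaf partial_sum_tree_def stored_def)
  then have t: "bal t" "partial_sum_tree t" and c: "contents t = [(act T, n)]"
    using weight_eq[of T] length_nodes_T by auto
  then show "size t = 1" using length_contents[of t] by simp
  show "sound (initial ins ins_cost T)"
    using t c total_eq[of t] node_at_act[of T] length_nodes_T
    by (auto simp: sound_def i stored_def revealed_def partial_sum_tree_def)
qed

text \<open>Everything about a single draw follows from one splitting of the contents at the sampled
  element, so its effect, its cost and the preservation of \<open>sound\<close> are collected
  here.\<close>

lemma advance_sound:
  assumes S: "sound S" and \<rho>: "\<rho> \<in> {1..total (mtree S)}"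
    and ap: "descend (mtree S) \<rho> = (a, p)"
    and tc: "insert_all ins ins_cost (children T a) (change_weight p 0 (mtree S), 0) = (t, c)"
  shows "advance ins ins_cost T S \<rho> = \<lparr>run = run S @ [a], mtree = t, draws = draws S @ [\<rho>],
           cost = cost S + 2 * (length p + 1) + c\<rparr>"
    and "sound (advance ins ins_cost T S \<rho>)"
    and "a \<in> revealed T (set (run S)) - set (run S)"
    and "(a, length p + 1) \<in> set (levels (mtree S))"
    and "\<And>K. cost_factor K \<Longrightarrow>
           real c \<le> K * (log 2 (real n + 1) + 1) * real (length (children T a))"
    and "size t = size (mtree S) + length (children T a)"
proof -
  let ?X = "set (run S)" and ?t = "mtree S" and ?ss = "children T a"
  let ?u = "change_weight p 0 (mtree S)"
  show adv: "advance ins ins_cost T S \<rho> = \<lparr>run = run S @ [a], mtree = t, draws = draws S @ [\<rho>],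
           cost = cost S + 2 * (length p + 1) + c\<rparr>"
    using ap tc by (simp add: advance_def)
  have sc: "sums_correct ?t" and d: "distinct (map fst (contents ?t))"
    and bal: "bal ?t" and pr: "partial_run T (run S)"
    and st: "set (stored ?t) = revealed T ?X"
    and w: "\<And>b k. (b, k) \<in> set (contents ?t) \<Longrightarrow> k = (if b \<in> ?X then 0 else subtree_size b)"
    and tot: "total ?t + length (run S) = n"
    using S by (auto simp: sound_def partial_sum_tree_def stored_def)
  obtain xs k ys where *: "contents ?t = xs @ (a, k) # ys"
      "sum_list (map snd xs) < \<rho>" "\<rho> \<le> sum_list (map snd xs) + k"
      "contents ?u = xs @ (a, 0) # ys" "sums_correct ?u" "(a, length p + 1) \<in> set (levels ?t)"
    using descend_cases[OF sc \<rho> ap] by blast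
  show "(a, length p + 1) \<in> set (levels ?t)" by fact
  \<comment> \<open>The interval of \<open>a\<close> contains \<rho> and so has positive length,
    whereas drawn actions have weight 0: \<open>a\<close> is new.\<close>
  have "k > 0" using * by linarith
  moreover have "k = (if a \<in> ?X then 0 else subtree_size a)" using w * by simp
  ultimately have aX: "a \<notin> ?X" and k: "k = subtree_size a" by (auto split: if_splits)
  have "a \<in> set (stored ?t)" using *(1) by (simp add: stored_def)
  then have ar: "a \<in> revealed T ?X" using st by simp
  with aX show en: "a \<in> revealed T ?X - ?X" by blast
  have X: "?X \<subseteq> set (actions T)" using partial_run_subset[OF pr] .
  have aA: "a \<in> set (actions T)" using revealed_subset[OF X] ar by blast
  have u: "stored ?u = stored ?t" using * by (simp add: stored_def)
  have pu: "partial_sum_tree ?u" using u d *(5) by (simp add: partial_sum_tree_def stored_def)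
  have fresh: "act s \<notin> revealed T ?X" if "s \<in> set ?ss" for s
    using children_fresh[OF X aA aX that] .
  have dss: "distinct (map act ?ss)"
    using distinct_act_subs[OF node_at(1)[OF aA]] by (simp add: children_eq)
  have disj: "act ` set ?ss \<inter> set (stored ?u) = {}" using fresh u st by auto
  have ws: "weight s = length (nodes s)" "node_at T (act s) = s" if "s \<in> set ?ss" for s
    using weight_eq node_at_act children_in_actions(1)[OF aA that] by auto
  have t: "bal t" "partial_sum_tree t"
      "mset (contents t) = mset (contents ?u) + mset (map (\<lambda>s. (act s, weight s)) ?ss)"
    using insert_all_spec[OF bal_change_weight[OF bal] pu dss disj tc] by auto
  show sz: "size t = size ?t + length ?ss"
    using arg_cong[OF t(3), of size] by (simp add: length_contents)
  have ct: "set (contents t) = set xs \<union> set ys \<union> {(a, 0)} \<union> (\<lambda>s. (act s, weight s)) ` set ?ss"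
    using arg_cong[OF t(3), of set_mset] *(4) by auto
  have "set (stored t) = set (stored ?u) \<union> act ` set ?ss"
    unfolding stored_def by (simp add: ct *(4) image_Un image_image)
  then have st': "set (stored t) = revealed T (insert a ?X)"
    using u st by (auto simp: revealed_def)
  have Xr: "?X \<subseteq> revealed T ?X" using partial_run_subset_revealed[OF pr] .
  \<comment> \<open>Old entries other than \<open>a\<close> keep their weights, \<open>a\<close> now
    has 0, and the inserted children are undrawn since every drawn action was revealed
    before.\<close>
  have w': "l = (if b \<in> insert a ?X then 0 else subtree_size b)" if bl: "(b, l) \<in> set (contents t)" for b l
  proof -
    consider "(b, l) \<in> set xs \<union> set ys" | "b = a" "l = 0" |
      s where "s \<in> set ?ss" "b = act s" "l = weight s"
      using bl ct by auto
    then show ?thesis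
    proof cases
      case 1
      then have "b \<noteq> a" using d *(1) by (force simp: image_iff)
      then show ?thesis using w[of b l] 1 *(1) by auto
    next
      case 3
      then show ?thesis using fresh ws ar Xr by auto
    qed simp
  qed
  have "total t = sum_list (map snd xs) + sum_list (map snd ys) + (\<Sum>s\<leftarrow>?ss. weight s)"
    using total_eq[of t] t(2) arg_cong[OF t(3), of "\<lambda>M. sum_mset (image_mset snd M)"] *(4)
    by (simp add: partial_sum_tree_def sum_list_mset image_mset.compositionality comp_def)
  also have "(\<Sum>s\<leftarrow>?ss. weight s) = (\<Sum>s\<leftarrow>?ss. length (nodes s))"
    using ws by (intro arg_cong[of _ _ sum_list] map_cong) auto
  finally have "Suc (total t) = total ?t"
    using total_eq[OF sc] *(1) k length_nodes[of "node_at T a"] by (simp add: children_eq)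
  then have "total t + length (run S @ [a]) = n" using tot by simp
  then show snd: "sound (advance ins ins_cost T S \<rho>)"
    using t st' w' pr en by (auto simp: sound_def adv partial_run_snoc)
  \<comment> \<open>The successor is already known to be sound, so its size bounds all trees that
    occur during the insertions.\<close>
  have N: "size ?u + length ?ss \<le> n" using sound_size[OF snd] sz by (simp add: adv)
  show "real c \<le> K * (log 2 (real n + 1) + 1) * real (length (children T a))" if "cost_factor K" for K
    using insert_all_cost[OF that bal_change_weight[OF bal] pu dss disj tc N] by simp
qed

lemma sound_advance:
  assumes "sound S" "\<rho> \<in> {1..total (mtree S)}"
  shows "sound (advance ins ins_cost T S \<rho>)"
  using advance_sound(2)[OF assms] by (metis surj_pair)


section \<open>Uniformity\<close>

text \<open>Each drawn action contributes its subtree size divided by the number of remaining draws;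
  the denominators multiply to \<open>fact m\<close>. Starting from an arbitrary sound configuration
  makes the induction work for every shape of the search tree.\<close>

lemma pmf_run_steps:
  assumes "sound S" "length (run S) + m = n" "length \<tau> = m"
  shows "pmf (map_pmf run (steps ins ins_cost T m S)) (run S @ \<tau>) =
    (if partial_run T (run S @ \<tau>) then (\<Prod>a\<leftarrow>\<tau>. real (subtree_size a)) / fact m else 0)"
  using assms
proof (induction m arbitrary: S \<tau>)
  case 0
  then show ?case by (simp add: sound_def)
next
  case (Suc m)
  obtain b \<tau>' where \<tau>: "\<tau> = b # \<tau>'" "length \<tau>' = m" using Suc.prems(3) by (cases \<tau>) auto
  have tot: "total (mtree S) = Suc m" using Suc.prems by (simp add: sound_def)
  let ?adv = "advance ins ins_cost T S" and ?A = "{1..total (mtree S)}"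
  let ?q = "if partial_run T (run S @ \<tau>) then (\<Prod>a\<leftarrow>\<tau>'. real (subtree_size a)) / fact m else 0"
  let ?B = "{\<rho> \<in> ?A. fst (descend (mtree S) \<rho>) = b}"
  \<comment> \<open>A draw can lead to the prescribed run only if it returns \<open>b\<close>. All
    such draws have the same continuation probability \<open>?q\<close>, so only their number
    matters.\<close>
  have branch: "pmf (map_pmf run (steps ins ins_cost T m (?adv \<rho>))) (run S @ \<tau>) =
      (if fst (descend (mtree S) \<rho>) = b then ?q else 0)" if \<rho>: "\<rho> \<in> ?A" for \<rho>
  proof (cases "fst (descend (mtree S) \<rho>) = b")
    case True
    then have "run (?adv \<rho>) @ \<tau>' = run S @ \<tau>" by (simp add: run_advance \<tau>)
    then show ?thesis
      using Suc.IH[OF sound_advance[OF Suc.prems(1) \<rho>], of \<tau>'] True Suc.prems \<tau>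
      by (simp add: run_advance)
  next
    case False
    have "run S @ \<tau> \<notin> set_pmf (map_pmf run (steps ins ins_cost T m (?adv \<rho>)))"
    proof
      assume "run S @ \<tau> \<in> set_pmf (map_pmf run (steps ins ins_cost T m (?adv \<rho>)))"
      then obtain S' where S': "S' \<in> set_pmf (steps ins ins_cost T m (?adv \<rho>))" "run S @ \<tau> = run S'"
        by auto
      then show False using run_steps[OF S'(1)] False \<tau> by (auto simp: run_advance)
    qed
    then show ?thesis using False by (simp only: pmf_eq_0_set_pmf if_False not_False_eq_True)
  qed
  have "map_pmf run (steps ins ins_cost T (Suc m) S) =
      bind_pmf (pmf_of_set ?A) (\<lambda>\<rho>. map_pmf run (steps ins ins_cost T m (?adv \<rho>)))"
    by (simp add: step_def map_bind_pmf bind_map_pmf)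
  then have "pmf (map_pmf run (steps ins ins_cost T (Suc m) S)) (run S @ \<tau>) =
      (\<Sum>\<rho>\<in>?A. pmf (map_pmf run (steps ins ins_cost T m (?adv \<rho>))) (run S @ \<tau>)) / real (card ?A)"
    using tot by (simp add: pmf_bind_pmf_of_set)
  also have "(\<Sum>\<rho>\<in>?A. pmf (map_pmf run (steps ins ins_cost T m (?adv \<rho>))) (run S @ \<tau>)) =
      (\<Sum>\<rho>\<in>?A. if fst (descend (mtree S) \<rho>) = b then ?q else 0)"
    by (intro sum.cong refl branch)
  also have "\<dots> = (\<Sum>\<rho>\<in>?B. ?q)"
    by (rule sum.inter_filter[symmetric]) simp
  also have "\<dots> = real (card ?B) * ?q" by simp
  finally have pmf: "pmf (map_pmf run (steps ins ins_cost T (Suc m) S)) (run S @ \<tau>) =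
      real (card ?B) * ?q / real (Suc m)"
    using tot by simp
  show ?case
  proof (cases "partial_run T (run S @ \<tau>)")
    case True
    then have "partial_run T ((run S @ [b]) @ \<tau>')" by (simp add: \<tau>)
    then have "partial_run T (run S @ [b])" by (rule partial_run_appendD)
    then have b: "b \<in> set (stored (mtree S))" "b \<notin> set (run S)"
      using Suc.prems by (auto simp: partial_run_snoc sound_def)
    then obtain k where k: "(b, k) \<in> set (contents (mtree S))" by (auto simp: stored_def)
    then have "k = subtree_size b" using Suc.prems b by (auto simp: sound_def)
    then have "card ?B = subtree_size b"
      using card_descend[OF _ k] Suc.prems by (simp add: sound_def)
    then show ?thesis using True pmf by (simp add: \<tau> field_simps)
  qed (use pmf in simp)
qed

lemma initial_props: "sound (initial ins ins_cost T)" "run (initial ins ins_cost T) = []"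
  using initial_sound by (metis config.simps(1) surj_pair)+

text \<open>The cost is charged to two counters: a draw pays for its descent and update through the
  length of the run, and an insertion pays through the size of the tree.\<close>

lemma random_execution_support:
  assumes K: "cost_factor K" and S': "S' \<in> set_pmf (random_execution ins ins_cost T)"
  shows "run S' \<in> concurrent_runs T" and "length (draws S') = n"
    and "real (cost S') \<le> 4 * K * (real n * (log 2 (real n + 1) + 1))"
proof -
  define C where "C = K * (log 2 (real n + 1) + 1)"
  have K0: "K \<ge> 0" and C0: "C \<ge> 0" using K by (auto simp: cost_factor_def C_def)
  define P where "P = (\<lambda>m S. sound S \<and> length (run S) + m = n \<and> length (draws S) = length (run S) \<and>
      real (cost S) \<le> 2 * C * real (length (run S) + size (mtree S)))"
  have "P 0 S'"
  proof (rule steps_invariant[OF _ _ _ S'[unfolded random_execution_def]])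
    obtain t c where tc: "insert_all ins ins_cost [T] (Leaf, 0) = (t, c)" by fastforce
    have "n \<ge> 1" using length_nodes_T length_nodes_pos[of T] by linarith
    then have "real c \<le> real 0 + K * (log 2 (real n + 1) + 1) * real (length [T])"
      by (intro insert_all_cost[OF K _ _ _ _ tc])
        (auto simp: bal_Leaf partial_sum_tree_def stored_def)
    then have "real c \<le> 2 * C * real (size t)"
      using C0 initial_sound(3)[OF tc] by (simp add: C_def)
    then show "P (length (nodes T)) (initial ins ins_cost T)"
      using initial_sound(1,2)[OF tc] length_nodes_T by (simp add: P_def)
  next
    fix m S assume "P (Suc m) S"
    then show "total (mtree S) > 0" by (auto simp: P_def sound_def)
  next
    fix m S \<rho> assume PS: "P (Suc m) S" and \<rho>: "\<rho> \<in> {1..total (mtree S)}"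
    then have S: "sound S" by (simp add: P_def)
    obtain a p where ap: "descend (mtree S) \<rho> = (a, p)" by fastforce
    obtain t c where
      tc: "insert_all ins ins_cost (children T a) (change_weight p 0 (mtree S), 0) = (t, c)" by fastforce
    note adv = advance_sound[OF S \<rho> ap tc]
    have "real (length p + 1) \<le> real (height (mtree S)) + 1"
      using levels_le_height[OF adv(4)] by simp
    also have "\<dots> \<le> K * (log 2 (real (size (mtree S)) + 1) + 1)"
      using K S by (auto simp: cost_factor_def sound_def)
    also have "\<dots> \<le> C"
      unfolding C_def using K0 sound_size[OF S] by (intro mult_left_mono) auto
    finally have p: "real (length p + 1) \<le> C" .
    have c: "real c \<le> C * real (length (children T a))" using adv(5)[OF K] by (simp add: C_def)
    have "0 \<le> C * real (length (children T a))" using C0 by simp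
    moreover have "real (cost S) \<le> 2 * C * real (length (run S) + size (mtree S))"
      using PS by (simp add: P_def)
    ultimately show "P m (advance ins ins_cost T S \<rho>)"
      using PS p c adv(2,6) by (simp add: P_def adv(1) algebra_simps)
  qed
  then have *: "sound S'" "length (run S') = n" "length (draws S') = n"
      "real (cost S') \<le> 2 * C * real (n + size (mtree S'))" by (auto simp: P_def)
  show "run S' \<in> concurrent_runs T" using sound_run * by blast
  show "length (draws S') = n" by fact
  \<comment> \<open>Both counters are at most \<open>n\<close> at the end, which turns the factor 2
    into 4.\<close>
  have "2 * C * real (n + size (mtree S')) \<le> 2 * C * real (n + n)"
    using C0 sound_size[OF *(1)] by (intro mult_left_mono) auto
  then show "real (cost S') \<le> 4 * K * (real n * (log 2 (real n + 1) + 1))"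
    using *(4) by (simp add: C_def algebra_simps)
qed

text \<open>The product of subtree sizes along a run ranges over all actions, so every concurrent
  run has the same probability \<open>q\<close>; total mass 1 then determines
  \<open>q\<close>.\<close>

lemma random_execution_uniform:
  "map_pmf run (random_execution ins ins_cost T) = pmf_of_set (concurrent_runs T)"
proof -
  let ?M = "map_pmf run (random_execution ins ins_cost T)"
  define q where "q = (\<Prod>a\<in>set (actions T). real (subtree_size a)) / fact n"
  have sub: "set_pmf ?M \<subseteq> concurrent_runs T"
    using cost_factor_exists random_execution_support(1) by auto
  have q: "pmf ?M \<sigma> = q" if "\<sigma> \<in> concurrent_runs T" for \<sigma>
  proof -
    have \<sigma>: "partial_run T \<sigma>" "length \<sigma> = n"
      using that partial_run_iff_concurrent_run length_nodes_T by auto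
    have "distinct \<sigma>" "set \<sigma> = set (actions T)" using that by (auto simp: concurrent_runs_def)
    then have "(\<Prod>a\<leftarrow>\<sigma>. real (subtree_size a)) = (\<Prod>a\<in>set (actions T). real (subtree_size a))"
      by (metis prod.distinct_set_conv_list)
    then show ?thesis
      using pmf_run_steps[OF initial_props(1), of n \<sigma>] \<sigma>
      by (simp add: q_def random_execution_def initial_props length_nodes_T)
  qed
  \<comment> \<open>A distribution has nonempty support, so existence of a run needs no separate
    construction.\<close>
  have ne: "concurrent_runs T \<noteq> {}" using sub set_pmf_not_empty[of ?M] by auto
  have "1 = (\<Sum>\<sigma>\<in>concurrent_runs T. pmf ?M \<sigma>)"
    using sum_pmf_eq_1[OF finite_concurrent_runs sub] by simp
  then have q': "q = 1 / real (card (concurrent_runs T))"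
    using q ne finite_concurrent_runs[of T] by (simp add: field_simps)
  show ?thesis
  proof (rule pmf_eqI)
    fix \<sigma>
    show "pmf ?M \<sigma> = pmf (pmf_of_set (concurrent_runs T)) \<sigma>"
    proof (cases "\<sigma> \<in> concurrent_runs T")
      case True
      then show ?thesis
        using q q' ne finite_concurrent_runs[of T] by simp
    next
      case False
      then have "pmf ?M \<sigma> = 0" using sub by (auto simp: pmf_eq_0_set_pmf)
      then show ?thesis using False ne finite_concurrent_runs[of T] by simp
    qed
  qed
qed


section \<open>The lower bound\<close>

text \<open>The part of the path length that belongs to stored elements still to be drawn.\<close>

definition pending :: "'a config \<Rightarrow> nat" where
  "pending S = (\<Sum>z\<leftarrow>levels (mtree S). if fst z \<in> set (run S) then 0 else snd z)"

text \<open>Distinct keys make \<open>(a, d)\<close> the only entry affected when \<open>a\<close>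
  joins the excluded set.\<close>

lemma sum_list_remove:
  fixes zs :: "('b \<times> nat) list"
  assumes "(a, d) \<in> set zs" "distinct (map fst zs)" "a \<notin> X"
  shows "(\<Sum>z\<leftarrow>zs. if fst z \<in> X then 0 else snd z) =
         d + (\<Sum>z\<leftarrow>zs. if fst z \<in> insert a X then 0 else snd z)"
  using assms
proof (induction zs)
  case (Cons z zs)
  show ?case
  proof (cases "z = (a, d)")
    case True
    then have "(\<Sum>z\<leftarrow>zs. if fst z \<in> X then 0 else snd z) =
        (\<Sum>z\<leftarrow>zs. if fst z \<in> insert a X then 0 else snd z)"
      using Cons.prems(2) by (intro arg_cong[of _ _ sum_list] map_cong) (auto simp: image_iff)
    then show ?thesis using True Cons.prems(3) by simp
  next
    case False
    then have "(a, d) \<in> set zs" using Cons.prems(1) by auto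
    then have "a \<in> fst ` set zs" by force
    then have "fst z \<noteq> a" using Cons.prems(2) by (auto simp: image_iff)
    then show ?thesis using Cons.IH \<open>(a, d) \<in> set zs\<close> Cons.prems by simp
  qed
qed simp

lemma distinct_levels: "sound S \<Longrightarrow> distinct (map fst (levels (mtree S)))"
  by (simp add: map_fst_levels sound_def partial_sum_tree_def)

text \<open>
  Once everything is stored the shape of the tree is frozen, and each element that is
  still to be drawn contributes its depth twice.
\<close>

lemma cost_ge_pending:
  assumes "sound S" "length (run S) + m = n" "set (stored (mtree S)) = set (actions T)"
    and "S' \<in> set_pmf (steps ins ins_cost T m S)"
  shows "cost S + 2 * pending S \<le> cost S'"
proof -
  \<comment> \<open>The sum of the cost and twice \<open>pending\<close> cannot decrease: a draw at
    depth d costs 2 d and lowers \<open>pending\<close> by d.\<close>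
  define P where "P = (\<lambda>m R. sound R \<and> length (run R) + m = n \<and>
      set (stored (mtree R)) = set (actions T) \<and> cost S + 2 * pending S \<le> cost R + 2 * pending R)"
  have "P 0 S'"
  proof (rule steps_invariant[OF _ _ _ assms(4)])
    show "P m S" using assms by (simp add: P_def)
  next
    fix m R assume "P (Suc m) R"
    then show "total (mtree R) > 0" by (auto simp: P_def sound_def)
  next
    fix m R \<rho> assume PR: "P (Suc m) R" and \<rho>: "\<rho> \<in> {1..total (mtree R)}"
    then have R: "sound R" and st: "set (stored (mtree R)) = set (actions T)" by (auto simp: P_def)
    obtain a p where ap: "descend (mtree R) \<rho> = (a, p)" by fastforce
    obtain t c where
      tc: "insert_all ins ins_cost (children T a) (change_weight p 0 (mtree R), 0) = (t, c)" by fastforce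
    note adv = advance_sound[OF R \<rho> ap tc]
    have X: "set (run R) \<subseteq> set (actions T)" and rev: "revealed T (set (run R)) = set (actions T)"
      using R st partial_run_subset[of T "run R"] by (simp_all add: sound_def)
    have aA: "a \<in> set (actions T)" and aX: "a \<notin> set (run R)" using adv(3) rev by auto
    \<comment> \<open>A child of the undrawn \<open>a\<close> would be unrevealed, but all actions
      are revealed. So nothing is inserted and the tree keeps its shape.\<close>
    have "c \<notin> set (children T a)" for c
      using children_fresh[OF X aA aX, of c] children_in_actions(2)[OF aA, of c] rev by simp blast
    then have "children T a = []" by (metis last_in_set)
    then have t: "t = change_weight p 0 (mtree R)" using tc by simp
    have "pending R = (length p + 1) + pending (advance ins ins_cost T R \<rho>)"
      using sum_list_remove[OF adv(4) distinct_levels[OF R] aX] by (simp add: pending_def adv(1) t)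
    moreover have "revealed T (set (run R @ [a])) = set (actions T)"
      using rev \<open>children T a = []\<close> by (simp add: revealed_def)
    ultimately show "P m (advance ins ins_cost T R \<rho>)"
      using PR adv(2) by (simp add: P_def adv(1) sound_def)
  qed
  then have *: "sound S'" "length (run S') = n" "cost S + 2 * pending S \<le> cost S' + 2 * pending S'"
    by (auto simp: P_def)
  have "set (run S') = set (actions T)" using sound_run[OF *(1,2)] by (simp add: concurrent_runs_def)
  moreover have "fst z \<in> set (actions T)" if "z \<in> set (levels (mtree S'))" for z
  proof -
    have "fst z \<in> set (stored (mtree S'))" using that by (simp flip: map_fst_levels)
    then show ?thesis
      using *(1) revealed_subset[OF partial_run_subset] by (auto simp: sound_def)
  qed
  ultimately have "pending S' = 0" by (auto simp: pending_def sum_list_eq_0_iff)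
  then show ?thesis using *(3) by simp
qed

text \<open>Drawing the root reveals all actions; from then on only the root's own depth is missing
  from \<open>pending\<close>. Of the subtracted \<open>2 * real n\<close>, one \<open>n\<close>
  converts external into internal path length and the other covers that depth.\<close>

lemma star_cost_ge:
  assumes star: "set (actions T) = revealed T {act T}"
    and S': "S' \<in> set_pmf (random_execution ins ins_cost T)"
  shows "2 * ((real n + 1) * log 2 (real n + 1) - 2 * real n) \<le> real (cost S')"
proof -
  let ?S = "initial ins ins_cost T"
  have n: "n = Suc (n - 1)" using length_nodes_T length_nodes_pos[of T] by linarith
  have tot: "total (mtree ?S) = n" using initial_props by (simp add: sound_def)
  have "S' \<in> set_pmf (steps ins ins_cost T (Suc (n - 1)) ?S)"
    using S' n by (simp add: random_execution_def length_nodes_T)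
  moreover have "set_pmf (pmf_of_set {1..total (mtree ?S)}) = {1..total (mtree ?S)}"
    using n tot by (intro set_pmf_of_set) auto
  ultimately obtain \<rho> where \<rho>: "\<rho> \<in> {1..total (mtree ?S)}"
    and S'1: "S' \<in> set_pmf (steps ins ins_cost T (n - 1) (advance ins ins_cost T ?S \<rho>))"
    by (auto simp: step_def)
  define S1 where "S1 = advance ins ins_cost T ?S \<rho>"
  obtain a p where ap: "descend (mtree ?S) \<rho> = (a, p)" by fastforce
  obtain t c where
    tc: "insert_all ins ins_cost (children T a) (change_weight p 0 (mtree ?S), 0) = (t, c)" by fastforce
  note adv = advance_sound[OF initial_props(1) \<rho> ap tc, folded S1_def]
  \<comment> \<open>Before the first draw only the root is revealed, so every admissible \<rho>
    returns it.\<close>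
  have run: "run S1 = [act T]" using adv(3) by (simp add: adv(1) revealed_def initial_props)
  have st: "set (stored (mtree S1)) = set (actions T)"
    using adv(2) star by (simp add: sound_def run)
  have "size (mtree S1) = length (stored (mtree S1))" by (simp add: stored_def length_contents)
  also have "\<dots> = n"
    using adv(2) st card_actions distinct_card[of "stored (mtree S1)"]
    by (simp add: sound_def partial_sum_tree_def)
  finally have size: "size (mtree S1) = n" .
  have "act T \<in> fst ` set (levels (mtree S1))"
    using st set_actions[of T] by (simp flip: map_fst_levels)
  then obtain d where d: "(act T, d) \<in> set (levels (mtree S1))" by auto
  \<comment> \<open>The crude bound by the size is enough, since it costs only a linear
    term.\<close>
  have "d \<le> n"
    using levels_le_height[OF d] height_le_size_tree[of "mtree S1"] size by linarith
  moreover have "sum_list (map snd (levels (mtree S1))) = d + pending S1"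
    using sum_list_remove[OF d distinct_levels[OF adv(2)], of "{}"] by (simp add: pending_def run)
  moreover have "cost S1 + 2 * pending S1 \<le> cost S'"
    using cost_ge_pending[OF adv(2) _ st, of "n - 1" S'] S'1 n run by (simp add: S1_def)
  moreover have "(real n + 1) * log 2 (real n + 1) \<le>
      real (sum_list (map snd (levels (mtree S1)))) + real n"
    using sum_levels_ge[of "mtree S1"] size by simp
  ultimately show ?thesis by (simp add: algebra_simps)
qed

end

text \<open>Infinitely many names supply stars of every positive size. The equation expresses that
  all nodes other than the root are its children.\<close>

lemma star_exists:
  assumes "infinite (UNIV :: 'a set)"
  shows "\<exists>T :: 'a process. T \<in> weighted_process_trees (Suc m) \<and> set (actions T) = revealed T {act T}"
proof -
  obtain A :: "'a set" where A: "finite A" "card A = Suc m"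
    using infinite_arbitrarily_large[OF assms] by blast
  then obtain xs where xs: "set xs = A" "distinct xs" using finite_distinct_list by blast
  then have "length xs = Suc m" using A distinct_card by metis
  then obtain x ys where x: "xs = x # ys" "length ys = m" by (cases xs) auto
  define T where "T = Process x (Suc m) (map (\<lambda>y. Process y 1 []) ys)"
  have nodes: "nodes T = T # map (\<lambda>y. Process y 1 []) ys"
    unfolding T_def by (induction ys) auto
  have acts: "actions T = x # ys" unfolding actions_def nodes by (simp add: T_def comp_def)
  have "T \<in> weighted_process_trees (Suc m)"
    using xs x by (auto simp: weighted_process_trees_def acts nodes) (simp add: T_def)
  moreover have "children T (act T) = subs T" by (simp add: children_def nodes)
  then have "set (actions T) = revealed T {act T}"
    unfolding acts by (simp add: revealed_def T_def image_image)
  ultimately show ?thesis by blast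
qed


section \<open>Asymptotic order of the worst-case cost\<close>

theorem proposition40:
  fixes bal :: "'a pst \<Rightarrow> bool"
    and ins :: "'a \<Rightarrow> nat \<Rightarrow> 'a pst \<Rightarrow> 'a pst"
    and ins_cost :: "'a \<Rightarrow> nat \<Rightarrow> 'a pst \<Rightarrow> nat"
  assumes "balanced_partial_sum_tree bal ins ins_cost"
    and "infinite (UNIV :: 'a set)"
  shows "(\<forall>n. \<forall>T \<in> weighted_process_trees n.
            map_pmf run (random_execution ins ins_cost T) = pmf_of_set (concurrent_runs T) \<and>
            (\<forall>S \<in> set_pmf (random_execution ins ins_cost T). length (draws S) = n)) \<and>
         (\<forall>n. finite (execution_costs ins ins_cost n)) \<and>
         (\<lambda>n. real (worst_case_cost ins ins_cost n)) \<in> \<Theta>(\<lambda>n. real n * ln (real n))"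
proof -
  interpret balanced_partial_sum_tree bal ins ins_cost by fact
  obtain K where K: "cost_factor K" using cost_factor_exists by blast
  let ?U = "\<lambda>n. real n * (log 2 (real n + 1) + 1)"
  let ?L = "\<lambda>n. 2 * ((real n + 1) * log 2 (real n + 1) - 2 * real n)"
  let ?W = "\<lambda>n. real (worst_case_cost ins ins_cost n)"
  have gen: "random_generation bal ins ins_cost T n" if "T \<in> weighted_process_trees n" for T n
    using that by unfold_locales
  have le: "real c \<le> 4 * K * ?U n" if "c \<in> execution_costs ins ins_cost n" for c n
    using that random_generation.random_execution_support(3)[OF gen K]
    by (auto simp: execution_costs_def)
  \<comment> \<open>Infinitely many trees share a size, but their costs are natural numbers below a
    common bound, so the maximum is a genuine one.\<close>
  have fin: "finite (execution_costs ins ins_cost n)" for n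
  proof (rule finite_subset)
    show "execution_costs ins ins_cost n \<subseteq> {..nat \<lfloor>4 * K * ?U n\<rfloor>}"
      using le by (auto simp: le_nat_floor)
  qed simp
  \<comment> \<open>Process trees are nonempty, so size 0 has no executions and its maximum is
    unspecified; the asymptotic claim ignores it.\<close>
  have worst: "?W n \<le> 4 * K * ?U n \<and> ?L n \<le> ?W n" if n: "n \<ge> 1" for n
  proof -
    obtain T :: "'a process" where T: "T \<in> weighted_process_trees n" "set (actions T) = revealed T {act T}"
      using star_exists[OF assms(2), of "n - 1"] n by auto
    obtain S where S: "S \<in> set_pmf (random_execution ins ins_cost T)"
      using set_pmf_not_empty[of "random_execution ins ins_cost T"] by blast
    then have c: "cost S \<in> execution_costs ins ins_cost n"
      using T by (auto simp: execution_costs_def)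
    have "worst_case_cost ins ins_cost n \<in> execution_costs ins ins_cost n"
      unfolding worst_case_cost_def using fin c by (intro Max_in) auto
    moreover have "cost S \<le> worst_case_cost ins ins_cost n"
      unfolding worst_case_cost_def using fin c by (intro Max_ge)
    moreover have "?L n \<le> real (cost S)"
      using random_generation.star_cost_ge[OF gen[OF T(1)] T(2) S] .
    ultimately show ?thesis using le[of _ n] by force
  qed
  have "?W \<in> O(?U)"
  proof (rule bigoI)
    show "\<forall>\<^sub>F n in sequentially. norm (?W n) \<le> 4 * K * norm (?U n)"
      using eventually_ge_at_top[of 1] by eventually_elim (use worst in auto)
  qed
  moreover have "?U \<in> O(\<lambda>n. real n * ln (real n))" by real_asymp
  ultimately have upper: "?W \<in> O(\<lambda>n. real n * ln (real n))" by (rule landau_o.big_trans)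
  \<comment> \<open>For small \<open>n\<close> the linear correction may make \<open>?L\<close>
    negative; eventual nonnegativity permits passing from the inequality to norms.\<close>
  have "\<forall>\<^sub>F n :: nat in sequentially. 0 \<le> ?L n" by real_asymp
  then have "\<forall>\<^sub>F n in sequentially. norm (?L n) \<le> 1 * norm (?W n)"
    using eventually_ge_at_top[of 1]
  proof eventually_elim
    case (elim n)
    then show ?case using worst[of n] by auto
  qed
  then have "?L \<in> O(?W)" by (rule bigoI)
  moreover have "(\<lambda>n. real n * ln (real n)) \<in> O(?L)" by real_asymp
  ultimately have "(\<lambda>n. real n * ln (real n)) \<in> O(?W)" by (meson landau_o.big_trans)
  then have "?W \<in> \<Theta>(\<lambda>n. real n * ln (real n))"
    using upper by (auto simp: bigtheta_def bigomega_iff_bigo)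
  moreover have "map_pmf run (random_execution ins ins_cost T) = pmf_of_set (concurrent_runs T) \<and>
      (\<forall>S \<in> set_pmf (random_execution ins ins_cost T). length (draws S) = n)"
    if "T \<in> weighted_process_trees n" for T n
    using random_generation.random_execution_uniform[OF gen[OF that]]
      random_generation.random_execution_support(2)[OF gen[OF that] K] by blast
  ultimately show ?thesis using fin by blast
qed

end
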